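(* Let $K$ be an algebraically closed field, $A$ a commutative ring and $\zeta:A\to K$ an EML-polynomial function of degree $d>0$ which is multiplicative in the sense that $\zeta(xy)=\zeta(x)\zeta(y)$ for all $x,y\in A$. Then $\zeta$ can be written as the (pointwise) product of $d$ ring morphisms from $A$ to $K$, which are unique up to the order of the factors.
   Context: Rings are unital and ring morphisms preserve units. For abelian groups $U,V$ and a map $f:U\to V$, the $d$-th deviation is $\delta_d(f)(u_1,\dots,u_d)=\sum_{I\subset\{1,\dots,d\}}(-1)^{d-|I|}f(\sum_{i\in I}u_i)$. The map $f$ is (EML-)polynomial of degree at most $d$ if $\delta_{d+1}(f)=0$, and of degree $d$ if moreover it is not of degree at most $d-1$. Here $A$ and $K$ are regarded as abelian groups under addition. *)

theory Defs
  imports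
    "HOL-Computational_Algebra.Polynomial"
    "HOL-Library.Multiset"
    "Jordan_Normal_Form.Ring_Hom_Matrix"
begin

text \<open>
  Commutative unital rings are rendered by the class \<^class>\<open>comm_ring_1\<close>, unital ring morphisms
  by the locale predicate \<^term>\<open>comm_ring_hom\<close> (from the AFP theory Ring_Hom), and algebraically
  closed fields by \<^class>\<open>alg_closed_field\<close>.
\<close>

text \<open>
  The deviation \<open>\<delta>\<^sub>d(f)(u\<^sub>1, \<dots>, u\<^sub>d)\<close>. The tuple is a function on \<^typ>\<open>nat\<close> of which only the values
  on \<open>{1..d}\<close> matter. The codomain is merely an abelian group, so the sign \<open>(-1)\<^bsup>d - |I|\<^esup>\<close> is
  written as a case distinction; \<open>card I \<le> d\<close>, so the subtraction does not truncate.
\<close>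

definition deviation ::
    "nat \<Rightarrow> ('a::ab_group_add \<Rightarrow> 'b::ab_group_add) \<Rightarrow> (nat \<Rightarrow> 'a) \<Rightarrow> 'b" where
  "deviation d f u =
     (\<Sum>I\<in>Pow {1..d}. if even (d - card I) then f (\<Sum>i\<in>I. u i) else - f (\<Sum>i\<in>I. u i))"

definition eml_degree_le :: "nat \<Rightarrow> ('a::ab_group_add \<Rightarrow> 'b::ab_group_add) \<Rightarrow> bool" where
  "eml_degree_le d f \<longleftrightarrow> (\<forall>u. deviation (Suc d) f u = 0)"

text \<open>
  The disjunct \<open>d = 0\<close> avoids the truncated \<open>0 - 1\<close>: every constant map, the zero map included,
  gets degree \<open>0\<close>.
\<close>

definition has_eml_degree :: "nat \<Rightarrow> ('a::ab_group_add \<Rightarrow> 'b::ab_group_add) \<Rightarrow> bool" where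
  "has_eml_degree d f \<longleftrightarrow> eml_degree_le d f \<and> (d = 0 \<or> \<not> eml_degree_le (d - 1) f)"

lemma eml_degree_le_0_iff: "eml_degree_le 0 f \<longleftrightarrow> (\<forall>x. f x = f 0)"
proof -
  have "deviation (Suc 0) f u = f (u 1) - f 0" for u
    by (simp add: deviation_def Pow_insert)
  then show ?thesis
    unfolding eml_degree_le_def by auto
qed

text \<open>
  The class \<^class>\<open>comm_ring_1\<close> excludes the zero ring. Maps out of a trivial group have degree at
  most \<open>0\<close>, so a statement about maps of positive degree is vacuous there and nothing is lost.
\<close>

lemma eml_degree_le_trivial_group:
  fixes f :: "'a::ab_group_add \<Rightarrow> 'b::ab_group_add"
  assumes "\<And>x :: 'a. x = 0"
  shows "eml_degree_le n f"
proof -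
  have "(\<Sum>I\<in>Pow {1..Suc n}. if even (Suc n - card I) then c else - c) = 0" for c :: 'b
  proof -
    let ?g = "\<lambda>I. if even (Suc n - card I) then c else - c"
    have fin: "finite {1..n}" by simp
    have eq: "{1..Suc n} = insert (Suc n) {1..n}" by auto
    have "sum ?g (Pow {1..Suc n})
        = sum ?g (Pow {1..n}) + sum ?g (insert (Suc n) ` Pow {1..n})"
      unfolding eq Pow_insert by (rule sum.union_disjoint) auto
    also have "sum ?g (insert (Suc n) ` Pow {1..n}) = (\<Sum>I\<in>Pow {1..n}. ?g (insert (Suc n) I))"
      proof -
      have "inj_on (insert (Suc n)) (Pow {1..n})"
      proof (rule inj_onI)
        fix I J assume IJ: "I \<in> Pow {1..n}" "J \<in> Pow {1..n}" "insert (Suc n) I = insert (Suc n) J"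
        have "Suc n \<notin> I" "Suc n \<notin> J" using IJ(1,2) by auto
        with IJ(3) show "I = J" by (metis insert_ident)
      qed
      from sum.reindex[OF this, of ?g] show ?thesis by (simp only: o_def)
    qed
    also have "\<dots> = (\<Sum>I\<in>Pow {1..n}. - ?g I)"
    proof (rule sum.cong[OF refl])
      fix I assume I: "I \<in> Pow {1..n}"
      then have "finite I" "Suc n \<notin> I" "card I \<le> n"
        using finite_subset[of I "{1..n}"] card_mono[OF fin, of I] by auto
      then show "?g (insert (Suc n) I) = - ?g I" by simp
    qed
    finally show ?thesis by (simp add: sum_negf)
  qed
  moreover have "deviation (Suc n) f u
      = (\<Sum>I\<in>Pow {1..Suc n}. if even (Suc n - card I) then f 0 else - f 0)" for u
    unfolding deviation_def
  proof (rule sum.cong[OF refl])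
    fix I assume "I \<in> Pow {1..Suc n}"
    have "f (\<Sum>i\<in>I. u i) = f 0" by (rule arg_cong[OF assms])
    then show "(if even (Suc n - card I) then f (\<Sum>i\<in>I. u i) else - f (\<Sum>i\<in>I. u i))
        = (if even (Suc n - card I) then f 0 else - f 0)" by (simp only:)
  qed
  ultimately show ?thesis
    unfolding eml_degree_le_def by (simp only: simp_thms)
qed

end

theory Submission
  imports Defs "HOL-Combinatorics.Permutations" "HOL-Library.FuncSet"
begin

text \<open>
  Write \<open>D = {1..d}\<close> and let \<open>B(x\<^sub>1, \<dots>, x\<^sub>d)\<close> be the \<open>d\<close>-th deviation of \<open>\<zeta>\<close>. Since \<open>\<zeta>\<close> has degree
  exactly \<open>d\<close>, the form \<open>B\<close> is additive in each argument and not zero. Multiplicativity of \<open>\<zeta>\<close> gives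
  \<open>B(a x\<^sub>1, \<dots>, a x\<^sub>d) = \<zeta>(a) B(x)\<close> and, expanding \<open>\<zeta>\<close> over the products \<open>x\<^sub>i y\<^sub>j\<close>, the shuffle identity
  \<open>B(x) B(y) = \<Sum>\<^sub>\<sigma> B(x\<^sub>1 y\<^bsub>\<sigma> 1\<^esub>, \<dots>, x\<^sub>d y\<^bsub>\<sigma> d\<^esub>)\<close> (\<open>cross_effect_mult\<close>).

  Conceptually, \<open>B\<close> is an additive form on \<open>A\<^bsup>\<otimes>d\<^esup>\<close>, and the shuffle identity says that the symmetric
  tensors act on the module of its translates through a ring morphism to \<open>K\<close>. As \<open>A\<^bsup>\<otimes>d\<^esup>\<close> is integral over
  the symmetric tensors and \<open>K\<close> is algebraically closed, this morphism extends to \<open>A\<^bsup>\<otimes>d\<^esup>\<close>; such an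
  extension is a \<open>d\<close>-tuple of ring morphisms \<open>A \<rightarrow> K\<close>, and its value at \<open>a \<otimes> \<dots> \<otimes> a\<close> is \<open>\<zeta>(a)\<close>.

  Tensor powers can be bypassed. \<open>A\<^sup>d\<close> acts on the functions \<open>A\<^sup>d \<rightarrow> K\<close> by translation; by Zorn's lemma there
  is an invariant subspace \<open>M\<close> maximal among those that do not contain \<open>B\<close>. If \<open>T\<close> is the
  multiplication by \<open>a\<close> in the \<open>k\<close>-th slot, then \<open>p(T) B = 0\<close> for a polynomial \<open>p\<close> over \<open>K\<close>, the analogue
  of \<open>\<Prod>\<^sub>i (X - a\<^sub>i)\<close> with \<open>a\<^sub>i\<close> the copy of \<open>a\<close> in slot \<open>i\<close>, because the elementary symmetric functions act on \<open>B\<close> by scalars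
  (\<open>Cayley_Hamilton\<close>). Maximality of \<open>M\<close> then makes \<open>B\<close> an eigenvector modulo \<open>M\<close>
  (\<open>maximal_avoiding_eigenvalue_exists\<close>). The eigenvalues, as functions of \<open>a\<close>, are the \<open>d\<close>
  morphisms sought (\<open>factor_characters\<close>).

  For uniqueness, if \<open>\<zeta> = \<Prod>\<^sub>k \<phi>\<^sub>k\<close> then \<open>B(x) = \<Sum>\<^sub>\<sigma> \<Prod>\<^sub>k \<phi>\<^sub>k(x\<^bsub>\<sigma> k\<^esub>)\<close>, a sum of characters of the monoid \<open>A\<^sup>d\<close>.
  Two factorizations without a common character would, by linear independence of characters, force
  \<open>B = 0\<close>; a common character shows that the two families agree up to a permutation.
\<close>

section \<open>Cross effects\<close>

text \<open>
  The deviation over an arbitrary finite index set. The proof needs index sets other than \<open>{1..d}\<close>: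
  subsets of it, and sets of pairs when a product of two deviations is expanded.
\<close>
definition cross_effect ::
    "('a::ab_group_add \<Rightarrow> 'b::comm_ring_1) \<Rightarrow> 'i set \<Rightarrow> ('i \<Rightarrow> 'a) \<Rightarrow> 'b" where
  "cross_effect f T z = (\<Sum>S\<in>Pow T. (-1) ^ card (T - S) * f (\<Sum>i\<in>S. z i))"

lemma sum_Pow_insert:
  assumes "finite T" "k \<notin> T"
  shows "sum g (Pow (insert k T)) = (\<Sum>S\<in>Pow T. g S + g (insert k S))"
proof -
  have "inj_on (insert k) (Pow T)"
    using assms(2) by (auto simp: inj_on_def)
  moreover have "Pow T \<inter> insert k ` Pow T = {}"
    using assms(2) by auto
  ultimately show ?thesis
    using assms(1) unfolding Pow_insert
    by (simp add: sum.union_disjoint sum.reindex sum.distrib)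
qed

lemma cross_effect_eq_deviation: "cross_effect f {1..d} u = deviation d f u"
  unfolding cross_effect_def deviation_def
proof (rule sum.cong[OF refl])
  fix I assume "I \<in> Pow {1..d}"
  then have "card ({1..d} - I) = d - card I"
    by (subst card_Diff_subset) (auto intro: finite_subset[OF _ finite_atLeastAtMost])
  then show "(-1) ^ card ({1..d} - I) * f (\<Sum>i\<in>I. u i) =
      (if even (d - card I) then f (\<Sum>i\<in>I. u i) else - f (\<Sum>i\<in>I. u i))"
    by simp
qed

lemma cross_effect_cong:
  assumes "\<And>i. i \<in> T \<Longrightarrow> z i = w i"
  shows "cross_effect f T z = cross_effect f T w"
  unfolding cross_effect_def using assms
  by (intro sum.cong refl arg_cong2[where f = "(*)"] arg_cong[where f = f]) auto

lemma cross_effect_image: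
  assumes "inj_on h T"
  shows "cross_effect f (h ` T) z = cross_effect f T (\<lambda>i. z (h i))"
proof -
  have inj: "inj_on ((`) h) (Pow T)"
    using assms by (rule inj_on_image_Pow)
  have "cross_effect f (h ` T) z =
      (\<Sum>S\<in>Pow T. (-1) ^ card (h ` T - h ` S) * f (\<Sum>i\<in>h ` S. z i))"
    unfolding cross_effect_def image_Pow_surj[OF refl, symmetric]
    by (subst sum.reindex[OF inj]) simp
  also have "\<dots> = cross_effect f T (\<lambda>i. z (h i))"
    unfolding cross_effect_def
  proof (rule sum.cong[OF refl])
    fix S assume "S \<in> Pow T"
    then have S: "S \<subseteq> T" by simp
    have "h ` T - h ` S = h ` (T - S)"
      using inj_on_image_set_diff[OF assms, of T S] S by auto
    moreover have "card (h ` (T - S)) = card (T - S)"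
      by (rule card_image) (meson assms Diff_subset inj_on_subset)
    moreover have "(\<Sum>i\<in>h ` S. z i) = (\<Sum>i\<in>S. z (h i))"
      by (subst sum.reindex) (use S assms in \<open>auto intro: inj_on_subset\<close>)
    ultimately show "(-1) ^ card (h ` T - h ` S) * f (\<Sum>i\<in>h ` S. z i) =
        (-1) ^ card (T - S) * f (\<Sum>i\<in>S. z (h i))" by simp
  qed
  finally show ?thesis .
qed

lemma cross_effect_insert:
  assumes "finite T" "k \<notin> T"
  shows "cross_effect f (insert k T) z =
    cross_effect (\<lambda>v. f (z k + v)) T z - cross_effect f T z"
proof -
  have "cross_effect f (insert k T) z =
      (\<Sum>S\<in>Pow T. (-1) ^ card (T - S) * f (z k + (\<Sum>i\<in>S. z i))
        - (-1) ^ card (T - S) * f (\<Sum>i\<in>S. z i))"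
    unfolding cross_effect_def sum_Pow_insert[OF assms]
  proof (rule sum.cong[OF refl])
    fix S assume "S \<in> Pow T"
    then have S: "S \<subseteq> T" "finite S" "k \<notin> S"
      using assms finite_subset by auto
    have "insert k T - S = insert k (T - S)" "insert k T - insert k S = T - S"
      using S assms by auto
    then show "(-1) ^ card (insert k T - S) * f (\<Sum>i\<in>S. z i)
          + (-1) ^ card (insert k T - insert k S) * f (\<Sum>i\<in>insert k S. z i)
        = (-1) ^ card (T - S) * f (z k + (\<Sum>i\<in>S. z i)) - (-1) ^ card (T - S) * f (\<Sum>i\<in>S. z i)"
      using S assms by simp
  qed
  then show ?thesis
    unfolding cross_effect_def by (simp add: sum_subtractf)
qed

text \<open>
  The cross effect in one more variable measures the failure of additivity in a given slot \<open>k\<close>. It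
  follows that cross effects of sufficiently high order vanish, and that those of the top order are
  additive in each variable.
\<close>

lemma cross_effect_insert_insert:
  fixes f :: "'a::ab_group_add \<Rightarrow> 'b::comm_ring_1"
  assumes "finite T" "k \<in> T" "m \<notin> T"
  shows "cross_effect f (insert m T) z =
    cross_effect f T (z(k := z k + z m)) - cross_effect f T z - cross_effect f T (z(k := z m))"
proof -
  define T' where "T' = T - {k}"
  have T: "T = insert k T'" "finite T'" "k \<notin> T'" "m \<notin> insert k T'" "m \<noteq> k"
    using assms by (auto simp: T'_def)
  have same: "cross_effect g T' (z(k := a)) = cross_effect g T' z"
    for a and g :: "'a \<Rightarrow> 'b"
    using T(3) by (intro cross_effect_cong) auto
  have 1: "cross_effect f (insert k T') (z(k := a)) =
      cross_effect (\<lambda>v. f (a + v)) T' z - cross_effect f T' z" for a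
    using T by (simp add: cross_effect_insert same)
  have 2: "cross_effect f (insert m (insert k T')) z =
     (cross_effect (\<lambda>v. f (z m + (z k + v))) T' z - cross_effect (\<lambda>v. f (z m + v)) T' z)
     - (cross_effect (\<lambda>v. f (z k + v)) T' z - cross_effect f T' z)"
    using T by (simp add: cross_effect_insert)
  have 3: "cross_effect f (insert k T') z =
      cross_effect (\<lambda>v. f (z k + v)) T' z - cross_effect f T' z"
    using T by (simp add: cross_effect_insert)
  show ?thesis
    unfolding T(1) 1 2 3 by (simp add: algebra_simps)
qed

lemma cross_effect_eq_0:
  fixes f :: "'a::ab_group_add \<Rightarrow> 'b::comm_ring_1" and T :: "'i set"
  assumes "eml_degree_le d f" "finite T" "card T > d"
  shows "cross_effect f T z = 0"
proof -
  have base: "cross_effect f T z = 0" if card: "card T = Suc d" for T :: "'i set" and z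
  proof -
    have "finite T" using card by (intro card_ge_0_finite) simp
    then have "\<exists>h. bij_betw h {1..card T} T" by (rule ex_bij_betw_nat_finite_1)
    then obtain h where h: "bij_betw h {1..Suc d} T" unfolding card by blast
    then have "cross_effect f T z = deviation (Suc d) f (\<lambda>i. z (h i))"
      using cross_effect_image[of h "{1..Suc d}" f z]
      by (simp add: bij_betw_def flip: cross_effect_eq_deviation)
    then show ?thesis using assms(1) by (simp add: eml_degree_le_def)
  qed
  have "\<forall>T :: 'i set. \<forall>z. finite T \<longrightarrow> card T = Suc (d + n) \<longrightarrow> cross_effect f T z = 0" for n
  proof (induction n)
    case 0
    then show ?case using base by simp
  next
    case (Suc n)
    show ?case
    proof (intro allI impI)
      fix T :: "'i set" and z assume T: "finite T" "card T = Suc (d + Suc n)"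
      then obtain m T1 where T1: "T = insert m T1" "m \<notin> T1" "card T1 = Suc (d + n)" "finite T1"
        by (metis add_Suc_right card_Suc_eq finite_insert)
      then obtain k where "k \<in> T1" by fastforce
      then show "cross_effect f T z = 0"
        using Suc T1 by (simp add: cross_effect_insert_insert)
    qed
  qed
  then show ?thesis using assms(2,3) less_imp_Suc_add by metis
qed

lemma sum_sign_Pow:
  assumes "finite X"
  shows "(\<Sum>S\<in>Pow X. (-1) ^ card S) = (if X = {} then 1 else (0 :: 'b::comm_ring_1))"
proof (cases "X = {}")
  case False
  then obtain k where "k \<in> X" by blast
  then obtain Y where X: "X = insert k Y" "k \<notin> Y" by (meson mk_disjoint_insert)
  then have "finite Y" using assms by simp
  have "(-1) ^ card S + (-1) ^ card (insert k S) = (0::'b)" if "S \<in> Pow Y" for S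
  proof -
    have "finite S" "k \<notin> S" using that \<open>finite Y\<close> X finite_subset by auto
    then show ?thesis by simp
  qed
  then show ?thesis
    using X \<open>finite Y\<close> by (simp add: sum_Pow_insert)
qed simp

text \<open>
  The Moebius function of the Boolean lattice: exactly the full set survives an alternating sum over
  the sets above \<open>R\<close>.
\<close>

lemma sum_sign_above:
  assumes "finite U" "R \<subseteq> U"
  shows "(\<Sum>S\<in>{S\<in>Pow U. R \<subseteq> S}. (-1) ^ card (U - S)) = (if R = U then 1 else (0 :: 'b::comm_ring_1))"
proof -
  have "(\<Sum>S\<in>{S\<in>Pow U. R \<subseteq> S}. (-1) ^ card (U - S)) = (\<Sum>S\<in>Pow (U - R). (-1) ^ card S :: 'b)"
    by (rule sum.reindex_bij_witness[of _ "\<lambda>W. U - W" "\<lambda>S. U - S"])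
       (use assms in \<open>auto simp: double_diff\<close>)
  then show ?thesis
    using sum_sign_Pow[of "U - R", where ?'b = 'b] assms by auto
qed

text \<open>
  If the values of \<open>f\<close> at partial sums are counted by terms \<open>h j\<close>, each contributing as soon as its
  support \<open>r j\<close> is reached, then the alternating sum keeps the terms of full support.
\<close>

lemma cross_effect_of_subset_sums:
  assumes "finite T" and "\<And>S. S \<subseteq> T \<Longrightarrow> f (\<Sum>i\<in>S. z i) = (\<Sum>j\<in>J. if r j \<subseteq> S then h j else 0)"
    and "finite J" "\<And>j. j \<in> J \<Longrightarrow> r j \<subseteq> T"
  shows "cross_effect f T z = (\<Sum>j\<in>{j\<in>J. r j = T}. h j)"
proof -
  have "cross_effect f T z =
      (\<Sum>S\<in>Pow T. (-1) ^ card (T - S) * (\<Sum>j\<in>J. if r j \<subseteq> S then h j else 0))"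
    unfolding cross_effect_def using assms(2) by (intro sum.cong) auto
  also have "\<dots> = (\<Sum>j\<in>J. \<Sum>S\<in>Pow T. if r j \<subseteq> S then (-1) ^ card (T - S) * h j else 0)"
    by (subst sum.swap) (simp add: sum_distrib_left if_distrib cong: if_cong)
  also have "\<dots> = (\<Sum>j\<in>J. \<Sum>S\<in>{S\<in>Pow T. r j \<subseteq> S}. (-1) ^ card (T - S) * h j)"
    using assms(1) by (intro sum.cong refl sum.inter_filter[symmetric]) auto
  also have "\<dots> = (\<Sum>j\<in>J. if r j = T then h j else 0)"
    using assms by (intro sum.cong refl)
      (simp add: sum_distrib_right[symmetric] sum_sign_above del: Pow_iff)
  also have "\<dots> = (\<Sum>j\<in>{j\<in>J. r j = T}. h j)"
    using assms(3) by (rule sum.inter_filter[symmetric])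
  finally show ?thesis .
qed

text \<open>
  Moebius inversion: every value at a sum is recovered from the cross effects over the subsets.
\<close>

lemma cross_effect_inversion:
  assumes "finite S"
  shows "f (\<Sum>i\<in>S. z i) = (\<Sum>T\<in>Pow S. cross_effect f T z)"
  using assms
proof (induction S arbitrary: f)
  case empty
  then show ?case by (simp add: cross_effect_def)
next
  case (insert k S)
  have fin: "finite T \<and> k \<notin> T" if "T \<in> Pow S" for T
    using that insert.hyps finite_subset by auto
  have "f (\<Sum>i\<in>insert k S. z i) = (\<Sum>T\<in>Pow S. cross_effect (\<lambda>v. f (z k + v)) T z)"
    using insert.IH[of "\<lambda>v. f (z k + v)"] insert.hyps by simp
  also have "\<dots> = (\<Sum>T\<in>Pow S. cross_effect f T z + cross_effect f (insert k T) z)"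
    using fin by (intro sum.cong refl) (simp add: cross_effect_insert)
  finally show ?case
    using insert.hyps by (simp add: sum_Pow_insert)
qed

text \<open>
  A relation on \<open>D\<close> with full projections has at least \<open>card D\<close> elements; in the case of equality both
  projections are injective, which makes it the graph of a permutation.
\<close>

lemma permutation_graphs:
  assumes "finite D"
  shows "{T. T \<subseteq> D \<times> D \<and> fst ` T = D \<and> snd ` T = D \<and> card T \<le> card D} =
    (\<lambda>\<sigma>. (\<lambda>i. (i, \<sigma> i)) ` D) ` {\<sigma>. \<sigma> permutes D}" (is "?L = ?R")
proof
  show "?R \<subseteq> ?L"
  proof
    fix T assume "T \<in> ?R"
    then obtain \<sigma> where \<sigma>: "\<sigma> permutes D" "T = (\<lambda>i. (i, \<sigma> i)) ` D" by auto
    then show "T \<in> ?L"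
      using permutes_in_image[OF \<sigma>(1)] permutes_image[OF \<sigma>(1)] card_image_le[OF assms]
      by (auto simp: image_image)
  qed
  show "?L \<subseteq> ?R"
  proof
    fix T assume "T \<in> ?L"
    then have T: "T \<subseteq> D \<times> D" "fst ` T = D" "snd ` T = D" "card T \<le> card D" by auto
    have finT: "finite T" using T(1) assms finite_subset by blast
    have inj: "inj_on fst T" "inj_on snd T"
      using T finT by (metis card_image_le eq_card_imp_inj_on le_antisym)+
    define \<sigma> where "\<sigma> i = (if i \<in> D then snd (inv_into T fst i) else i)" for i
    have val: "(i, \<sigma> i) \<in> T" if "i \<in> D" for i
      using that inv_into_into[of i fst T] f_inv_into_f[of i fst T] T(2)
      by (auto simp: \<sigma>_def) (metis prod.collapse)
    have graph: "T = (\<lambda>i. (i, \<sigma> i)) ` D"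
    proof
      show "(\<lambda>i. (i, \<sigma> i)) ` D \<subseteq> T" using val by auto
      show "T \<subseteq> (\<lambda>i. (i, \<sigma> i)) ` D"
      proof
        fix t assume t: "t \<in> T"
        then have i: "fst t \<in> D" using T(2) by auto
        from inj(1) have "t = (fst t, \<sigma> (fst t))"
          by (rule inj_onD) (use t val[OF i] in auto)
        then show "t \<in> (\<lambda>i. (i, \<sigma> i)) ` D" using i by auto
      qed
    qed
    have "\<sigma> ` D = D" using T(3) by (simp add: graph image_image)
    then have "bij_betw \<sigma> D D"
      using assms by (simp add: bij_betw_def eq_card_imp_inj_on)
    then have "\<sigma> permutes D"
      by (rule bij_imp_permutes) (simp add: \<sigma>_def)
    then show "T \<in> ?R" using graph by blast
  qed
qed

lemma inj_on_permutation_graph: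
  "inj_on (\<lambda>\<sigma>. (\<lambda>i. (i, \<sigma> i)) ` D) {\<sigma>. \<sigma> permutes D}"
proof (rule inj_onI, rule ext)
  fix \<sigma> \<tau> i
  assume "\<sigma> \<in> {\<sigma>. \<sigma> permutes D}" "\<tau> \<in> {\<sigma>. \<sigma> permutes D}"
    and eq: "(\<lambda>i. (i, \<sigma> i)) ` D = (\<lambda>i. (i, \<tau> i)) ` D"
  then have "\<sigma> permutes D" "\<tau> permutes D" by auto
  then show "\<sigma> i = \<tau> i"
    using eq by (cases "i \<in> D") (auto simp: permutes_not_in)
qed

text \<open>
  The product of two partial sums \<open>\<Sum>\<^bsub>i\<in>I\<^esub> x\<^sub>i\<close> and \<open>\<Sum>\<^bsub>j\<in>J\<^esub> y\<^sub>j\<close> is the sum of \<open>x\<^sub>i y\<^sub>j\<close> over \<open>I \<times> J\<close>. Expand \<open>f\<close> there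
  by inversion into cross effects over relations \<open>T \<subseteq> I \<times> J\<close>; the alternating sums over \<open>I\<close> and \<open>J\<close>
  keep the relations with full projections. Among these, the degree bound kills all but the graphs of
  permutations.
\<close>

lemma cross_effect_mult:
  fixes f :: "'a::comm_ring_1 \<Rightarrow> 'b::comm_ring_1"
  assumes deg: "eml_degree_le (card D) f" and mult: "\<And>x y. f (x * y) = f x * f y" and "finite D"
  shows "cross_effect f D x * cross_effect f D y =
    (\<Sum>\<sigma> | \<sigma> permutes D. cross_effect f D (\<lambda>i. x i * y (\<sigma> i)))"
proof -
  define z where "z = (\<lambda>(i, j). x i * y j)"
  define ind :: "bool \<Rightarrow> 'b" where "ind b = (if b then 1 else 0)" for b
  let ?P = "Pow (D \<times> D)"
  have finDD: "finite (D \<times> D)" using assms by simp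
  have sums: "f (\<Sum>i\<in>I. x i) * f (\<Sum>j\<in>J. y j) =
      (\<Sum>T\<in>?P. ind (fst ` T \<subseteq> I) * ind (snd ` T \<subseteq> J) * cross_effect f T z)"
    if "I \<subseteq> D" "J \<subseteq> D" for I J
  proof -
    have fin: "finite (I \<times> J)" using that assms finite_subset by blast
    have "f (\<Sum>i\<in>I. x i) * f (\<Sum>j\<in>J. y j) = f (\<Sum>t\<in>I \<times> J. z t)"
      by (simp add: mult[symmetric] sum_product sum.cartesian_product z_def)
    also have "\<dots> = (\<Sum>T\<in>Pow (I \<times> J). cross_effect f T z)"
      using fin by (rule cross_effect_inversion)
    also have "\<dots> = (\<Sum>T\<in>?P. ind (fst ` T \<subseteq> I) * ind (snd ` T \<subseteq> J) * cross_effect f T z)"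
    proof (rule sum.mono_neutral_cong_left)
      show "\<forall>T\<in>?P - Pow (I \<times> J). ind (fst ` T \<subseteq> I) * ind (snd ` T \<subseteq> J) * cross_effect f T z = 0"
      proof
        fix T assume T: "T \<in> ?P - Pow (I \<times> J)"
        then have "\<not> (fst ` T \<subseteq> I \<and> snd ` T \<subseteq> J)" by fastforce
        then show "ind (fst ` T \<subseteq> I) * ind (snd ` T \<subseteq> J) * cross_effect f T z = 0"
          by (auto simp: ind_def)
      qed
      fix T assume "T \<in> Pow (I \<times> J)"
      then have "fst ` T \<subseteq> I" "snd ` T \<subseteq> J" by auto
      then show "cross_effect f T z = ind (fst ` T \<subseteq> I) * ind (snd ` T \<subseteq> J) * cross_effect f T z"
        by (simp add: ind_def)
    qed (use that finDD in auto)
    finally show ?thesis .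
  qed
  have above: "(\<Sum>I\<in>Pow D. (-1) ^ card (D - I) * ind (R \<subseteq> I)) = ind (R = D)" if "R \<subseteq> D" for R
  proof -
    have "(\<Sum>I\<in>Pow D. (-1) ^ card (D - I) * ind (R \<subseteq> I)) =
        (\<Sum>I\<in>Pow D. if R \<subseteq> I then (-1) ^ card (D - I) else 0)"
      by (intro sum.cong) (auto simp: ind_def)
    also have "\<dots> = (\<Sum>I\<in>{I\<in>Pow D. R \<subseteq> I}. (-1) ^ card (D - I))"
      using \<open>finite D\<close> by (intro sum.inter_filter[symmetric]) auto
    finally show ?thesis using sum_sign_above[OF \<open>finite D\<close> that] by (simp add: ind_def)
  qed
  have "cross_effect f D x * cross_effect f D y =
      (\<Sum>I\<in>Pow D. \<Sum>J\<in>Pow D. (-1) ^ card (D - I) * (-1) ^ card (D - J)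
        * (f (\<Sum>i\<in>I. x i) * f (\<Sum>j\<in>J. y j)))"
    unfolding cross_effect_def sum_product by (simp add: mult_ac)
  also have "\<dots> = (\<Sum>I\<in>Pow D. \<Sum>J\<in>Pow D. \<Sum>T\<in>?P. cross_effect f T z *
        ((-1) ^ card (D - I) * ind (fst ` T \<subseteq> I)) * ((-1) ^ card (D - J) * ind (snd ` T \<subseteq> J)))"
    by (intro sum.cong refl) (simp add: sums sum_distrib_left mult_ac)
  also have "\<dots> = (\<Sum>I\<in>Pow D. \<Sum>T\<in>?P. \<Sum>J\<in>Pow D. cross_effect f T z *
        ((-1) ^ card (D - I) * ind (fst ` T \<subseteq> I)) * ((-1) ^ card (D - J) * ind (snd ` T \<subseteq> J)))"
    by (intro sum.cong refl sum.swap)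
  also have "\<dots> = (\<Sum>T\<in>?P. \<Sum>I\<in>Pow D. \<Sum>J\<in>Pow D. cross_effect f T z *
        ((-1) ^ card (D - I) * ind (fst ` T \<subseteq> I)) * ((-1) ^ card (D - J) * ind (snd ` T \<subseteq> J)))"
    by (rule sum.swap)
  also have "\<dots> = (\<Sum>T\<in>?P. cross_effect f T z *
        (\<Sum>I\<in>Pow D. (-1) ^ card (D - I) * ind (fst ` T \<subseteq> I)) *
        (\<Sum>J\<in>Pow D. (-1) ^ card (D - J) * ind (snd ` T \<subseteq> J)))"
    by (simp only: sum_distrib_left[symmetric] sum_distrib_right[symmetric])
  also have "\<dots> = (\<Sum>T\<in>?P. cross_effect f T z * ind (fst ` T = D) * ind (snd ` T = D))"
  proof (rule sum.cong[OF refl])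
    fix T assume "T \<in> ?P"
    then have "fst ` T \<subseteq> D" "snd ` T \<subseteq> D" by auto
    then show "cross_effect f T z *
        (\<Sum>I\<in>Pow D. (-1) ^ card (D - I) * ind (fst ` T \<subseteq> I)) *
        (\<Sum>J\<in>Pow D. (-1) ^ card (D - J) * ind (snd ` T \<subseteq> J)) =
        cross_effect f T z * ind (fst ` T = D) * ind (snd ` T = D)"
      by (simp add: above)
  qed
  also have "\<dots> = (\<Sum>T | T \<subseteq> D \<times> D \<and> fst ` T = D \<and> snd ` T = D \<and> card T \<le> card D.
      cross_effect f T z)"
  proof (rule sum.mono_neutral_cong_right)
    show "\<forall>T\<in>?P - {T. T \<subseteq> D \<times> D \<and> fst ` T = D \<and> snd ` T = D \<and> card T \<le> card D}.
        cross_effect f T z * ind (fst ` T = D) * ind (snd ` T = D) = 0"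
    proof
      fix T assume T: "T \<in> ?P - {T. T \<subseteq> D \<times> D \<and> fst ` T = D \<and> snd ` T = D \<and> card T \<le> card D}"
      then have "finite T" using finDD finite_subset by auto
      then have "card T > card D \<Longrightarrow> cross_effect f T z = 0"
        using cross_effect_eq_0[OF deg] by blast
      then show "cross_effect f T z * ind (fst ` T = D) * ind (snd ` T = D) = 0"
        using T by (auto simp: ind_def not_le)
    qed
  qed (use finDD in \<open>auto simp: ind_def\<close>)
  also have "\<dots> = (\<Sum>\<sigma> | \<sigma> permutes D. cross_effect f ((\<lambda>i. (i, \<sigma> i)) ` D) z)"
    unfolding permutation_graphs[OF \<open>finite D\<close>]
    by (subst sum.reindex[OF inj_on_permutation_graph]) simp
  also have "\<dots> = (\<Sum>\<sigma> | \<sigma> permutes D. cross_effect f D (\<lambda>i. x i * y (\<sigma> i)))"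
    by (intro sum.cong refl) (subst cross_effect_image, auto simp: inj_on_def z_def)
  finally show ?thesis .
qed

lemma cross_effect_scale:
  fixes f :: "'a::comm_ring_1 \<Rightarrow> 'b::comm_ring_1"
  assumes "\<And>x y. f (x * y) = f x * f y"
  shows "cross_effect f T (\<lambda>i. a * x i) = f a * cross_effect f T x"
  unfolding cross_effect_def
  by (simp add: sum_distrib_left[symmetric] assms) (simp add: sum_distrib_left mult_ac)

section \<open>Translation-invariant subspaces\<close>

definition translate ::
    "('i \<Rightarrow> 'a::comm_ring_1) \<Rightarrow> (('i \<Rightarrow> 'a) \<Rightarrow> 'k) \<Rightarrow> ('i \<Rightarrow> 'a) \<Rightarrow> 'k" where
  "translate y F = (\<lambda>x. F (\<lambda>i. x i * y i))"

definition invariant_subspace :: "(('i \<Rightarrow> 'a::comm_ring_1) \<Rightarrow> 'k::field) set \<Rightarrow> bool" where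
  "invariant_subspace M \<longleftrightarrow>
     (\<lambda>_. 0) \<in> M \<and> (\<forall>F\<in>M. \<forall>G\<in>M. (\<lambda>x. F x + G x) \<in> M) \<and>
     (\<forall>c. \<forall>F\<in>M. (\<lambda>x. c * F x) \<in> M) \<and> (\<forall>y. \<forall>F\<in>M. translate y F \<in> M)"

lemma invariant_subspaceD:
  assumes "invariant_subspace M"
  shows "(\<lambda>_. 0) \<in> M" "F \<in> M \<Longrightarrow> G \<in> M \<Longrightarrow> (\<lambda>x. F x + G x) \<in> M"
    "F \<in> M \<Longrightarrow> (\<lambda>x. c * F x) \<in> M" "F \<in> M \<Longrightarrow> translate y F \<in> M"
  using assms unfolding invariant_subspace_def by auto

lemma invariant_subspace_diff:
  assumes "invariant_subspace M" "F \<in> M" "G \<in> M"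
  shows "(\<lambda>x. F x - G x) \<in> M"
  using invariant_subspaceD(2)[OF assms(1,2) invariant_subspaceD(3)[OF assms(1,3), of "-1"]]
  by simp

definition maximal_avoiding ::
    "(('i \<Rightarrow> 'a::comm_ring_1) \<Rightarrow> 'k::field) \<Rightarrow> (('i \<Rightarrow> 'a) \<Rightarrow> 'k) set \<Rightarrow> bool" where
  "maximal_avoiding B M \<longleftrightarrow> invariant_subspace M \<and> B \<notin> M \<and>
     (\<forall>N. invariant_subspace N \<longrightarrow> M \<subset> N \<longrightarrow> B \<in> N)"

lemma maximal_avoiding_exists:
  fixes B :: "('i \<Rightarrow> 'a::comm_ring_1) \<Rightarrow> 'k::field"
  assumes "B \<noteq> (\<lambda>_. 0)"
  shows "\<exists>M. maximal_avoiding B M"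
proof -
  define \<A> where "\<A> = {M. invariant_subspace M \<and> B \<notin> M}"
  have "\<exists>M\<in>\<A>. \<forall>X\<in>\<A>. M \<subseteq> X \<longrightarrow> X = M"
  proof (rule subset_Zorn_nonempty)
    have "{\<lambda>_. 0} \<in> \<A>"
      using assms by (auto simp: \<A>_def invariant_subspace_def translate_def)
    then show "\<A> \<noteq> {}" by blast
  next
    fix \<C> assume C: "\<C> \<noteq> {}" "subset.chain \<A> \<C>"
    then have inv: "invariant_subspace M" "B \<notin> M" if "M \<in> \<C>" for M
      using that by (auto simp: \<A>_def subset.chain_def)
    have "(\<lambda>x. F x + G x) \<in> \<Union>\<C>" if FG: "F \<in> \<Union>\<C>" "G \<in> \<Union>\<C>" for F G
    proof -
      obtain M N where M: "M \<in> \<C>" "F \<in> M" "N \<in> \<C>" "G \<in> N" using FG by auto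
      then have "M \<subseteq> N \<or> N \<subseteq> M"
        using C(2) by (auto simp: subset_chain_def)
      then obtain L where L: "L \<in> \<C>" "F \<in> L" "G \<in> L" using M by blast
      then show ?thesis using invariant_subspaceD(2)[OF inv(1)[OF L(1)]] by blast
    qed
    then have "invariant_subspace (\<Union>\<C>)"
      unfolding invariant_subspace_def using C(1) invariant_subspaceD(1,3,4)[OF inv(1)] by blast
    then show "\<Union>\<C> \<in> \<A>" using inv(2) by (auto simp: \<A>_def)
  qed
  then show ?thesis
    unfolding \<A>_def maximal_avoiding_def by blast
qed

text \<open>
  Translations commute, so the functions that \<open>translate y - c\<close> sends into \<open>M\<close> form an invariant
  subspace. It contains \<open>M\<close>, properly because of \<open>G\<close>, hence it contains \<open>B\<close> by maximality.
\<close>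

lemma maximal_avoiding_eigenvalue:
  assumes M: "maximal_avoiding B M"
    and G: "(\<lambda>x. translate y G x - c * G x) \<in> M" "G \<notin> M"
  shows "(\<lambda>x. translate y B x - c * B x) \<in> M"
proof -
  have inv: "invariant_subspace M" using M by (simp add: maximal_avoiding_def)
  let ?E = "\<lambda>F x. translate y F x - c * F x"
  define N where "N = {F. ?E F \<in> M}"
  have "?E (\<lambda>_. 0) = (\<lambda>_. 0)" by (simp add: translate_def)
  moreover have "?E (\<lambda>x. F x + G x) = (\<lambda>x. ?E F x + ?E G x)" for F G
    by (simp add: translate_def algebra_simps)
  moreover have "?E (\<lambda>x. u * F x) = (\<lambda>x. u * ?E F x)" for u F
    by (simp add: translate_def algebra_simps)
  moreover have E_translate: "?E (translate z F) = translate z (?E F)" for z F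
    by (simp add: translate_def mult_ac)
  ultimately have "invariant_subspace N"
    using invariant_subspaceD[OF inv] unfolding invariant_subspace_def N_def by simp
  moreover have "M \<subseteq> N"
    using invariant_subspace_diff[OF inv] invariant_subspaceD(3,4)[OF inv] by (auto simp: N_def)
  moreover have "G \<in> N" using G by (simp add: N_def)
  ultimately have "B \<in> N"
    using M G(2) unfolding maximal_avoiding_def by blast
  then show ?thesis by (simp add: N_def)
qed

text \<open>
  With \<open>b i\<close> standing for \<open>T\<^sup>i v\<close>, this is the identity \<open>((X - c) q)(T) v = (T - c) (q(T) v)\<close>.
\<close>

lemma sum_coeff_linear_factor:
  fixes q :: "'k::comm_ring_1 poly"
  assumes "degree q \<le> n"
  shows "(\<Sum>i\<le>Suc n. coeff ([:-c, 1:] * q) i * b i) =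
    (\<Sum>i\<le>n. coeff q i * b (Suc i)) - c * (\<Sum>i\<le>n. coeff q i * b i)"
proof -
  have "(\<Sum>i\<le>Suc n. coeff ([:-c, 1:] * q) i * b i) =
      (\<Sum>i\<le>Suc n. coeff (pCons 0 q) i * b i) - c * (\<Sum>i\<le>Suc n. coeff q i * b i)"
    unfolding sum_distrib_left sum_subtractf[symmetric]
    by (intro sum.cong refl) (simp add: algebra_simps)
  also have "(\<Sum>i\<le>Suc n. coeff (pCons 0 q) i * b i) = (\<Sum>i\<le>n. coeff q i * b (Suc i))"
    by (subst sum.atMost_Suc_shift) simp
  also have "(\<Sum>i\<le>Suc n. coeff q i * b i) = (\<Sum>i\<le>n. coeff q i * b i)"
    using assms by (simp add: coeff_eq_0)
  finally show ?thesis .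
qed

text \<open>
  Split off a root \<open>c\<close> of an annihilating polynomial, \<open>p = (X - c) q\<close>. Either \<open>q\<close> annihilates \<open>B\<close> modulo
  \<open>M\<close> already and has smaller degree, or \<open>q(T) B\<close> is an eigenvector modulo \<open>M\<close> outside \<open>M\<close>, so that \<open>c\<close> is
  the eigenvalue of \<open>B\<close> as well.
\<close>

lemma maximal_avoiding_eigenvalue_exists:
  fixes B :: "('i \<Rightarrow> 'a::comm_ring_1) \<Rightarrow> 'k::alg_closed_field"
  assumes M: "maximal_avoiding B M" and "p \<noteq> 0"
    and "(\<lambda>x. \<Sum>i\<le>degree p. coeff p i * B (\<lambda>j. x j * y j ^ i)) \<in> M"
  shows "\<exists>c. (\<lambda>x. translate y B x - c * B x) \<in> M"
  using assms(2,3)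
proof (induction "degree p" arbitrary: p)
  case 0
  have inv: "invariant_subspace M" using M by (simp add: maximal_avoiding_def)
  have "coeff p 0 \<noteq> 0" using 0 by (metis leading_coeff_0_iff)
  moreover have "(\<lambda>x. coeff p 0 * B x) \<in> M"
    using 0 by simp
  then have "(\<lambda>x. inverse (coeff p 0) * (coeff p 0 * B x)) \<in> M"
    by (rule invariant_subspaceD(3)[OF inv])
  ultimately have "B \<in> M" by (simp add: mult.assoc[symmetric])
  then show ?case using M by (simp add: maximal_avoiding_def)
next
  case (Suc n)
  obtain c where "poly p c = 0"
    using alg_closed_imp_poly_has_root[of p] Suc.hyps(2) by auto
  then obtain q where q: "p = [:-c, 1:] * q"
    unfolding poly_eq_0_iff_dvd by (elim dvdE)
  have "q \<noteq> 0" using q Suc.prems(1) by auto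
  then have deg: "degree q = n"
    using Suc.hyps(2) degree_mult_eq[of "[:-c, 1:]" q] by (simp add: q del: mult_pCons_left)
  define G where "G = (\<lambda>x. \<Sum>i\<le>n. coeff q i * B (\<lambda>j. x j * y j ^ i))"
  have "translate y G x - c * G x = (\<Sum>i\<le>degree p. coeff p i * B (\<lambda>j. x j * y j ^ i))" for x
    using sum_coeff_linear_factor[of q n c "\<lambda>i. B (\<lambda>j. x j * y j ^ i)"] deg
    unfolding Suc.hyps(2)[symmetric] q[symmetric] by (simp add: translate_def G_def mult.assoc)
  then have *: "(\<lambda>x. translate y G x - c * G x) \<in> M"
    using Suc.prems(2) by simp
  show ?case
  proof (cases "G \<in> M")
    case True
    then show ?thesis
      using Suc.hyps(1)[OF deg[symmetric] \<open>q \<noteq> 0\<close>] by (simp add: G_def deg)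
  next
    case False
    then show ?thesis using maximal_avoiding_eigenvalue[OF M *] by blast
  qed
qed

section \<open>Shuffle forms\<close>

text \<open>
  The translation by \<open>slot k a\<close> plays the role of \<open>1 \<otimes> \<dots> \<otimes> a \<otimes> \<dots> \<otimes> 1\<close>, with \<open>a\<close> at position \<open>k\<close>.
\<close>

definition slot :: "'i \<Rightarrow> 'a::comm_ring_1 \<Rightarrow> 'i \<Rightarrow> 'a" where
  "slot k a = (\<lambda>i. if i = k then a else 1)"

text \<open>
  These are the properties of the top deviation of a multiplicative polynomial map that the existence
  proof uses. The forms \<open>B(x) = \<Sum>\<^sub>\<sigma> \<Prod>\<^sub>k \<phi>\<^sub>k(x\<^bsub>\<sigma> k\<^esub>)\<close> with ring morphisms \<open>\<phi>\<^sub>k\<close> have them, unless they vanish.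
\<close>

locale shuffle_form =
  fixes D :: "'i set" and B :: "('i \<Rightarrow> 'a::comm_ring_1) \<Rightarrow> 'k::alg_closed_field"
  assumes finite_D: "finite D"
    and local: "(\<And>i. i \<in> D \<Longrightarrow> x i = y i) \<Longrightarrow> B x = B y"
    and additive: "k \<in> D \<Longrightarrow> B (x(k := a + b)) = B (x(k := a)) + B (x(k := b))"
    and shuffle: "B x * B y = (\<Sum>\<sigma> | \<sigma> permutes D. B (\<lambda>i. x i * y (\<sigma> i)))"
    and nonzero: "\<exists>e. B e \<noteq> 0"
begin

text \<open>
  The operator on the left is translation by the \<open>j\<close>-th elementary symmetric function in the slot
  copies of \<open>a\<close>. Multiply by \<open>B e \<noteq> 0\<close> and apply the shuffle identity: a symmetric factor can be
  moved from \<open>x\<close> to the permuted \<open>e\<close>, where it acts on the constant \<open>B e\<close>.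
\<close>

lemma elementary_symmetric_scalar:
  "\<exists>c. \<forall>x. (\<Sum>S | S \<subseteq> D \<and> card S = j. B (\<lambda>i. x i * (if i \<in> S then a else 1))) = c * B x"
proof -
  define ind where "ind S i = (if i \<in> S then a else 1)" for S and i :: 'i
  let ?P = "{S. S \<subseteq> D \<and> card S = j}"
  obtain e where e: "B e \<noteq> 0" using nonzero by blast
  have "(\<Sum>S\<in>?P. B (\<lambda>i. x i * ind S i)) * B e = (\<Sum>S\<in>?P. B (\<lambda>i. e i * ind S i)) * B x" for x
  proof -
    have "(\<Sum>S\<in>?P. B (\<lambda>i. x i * ind S i)) * B e =
        (\<Sum>S\<in>?P. \<Sum>\<sigma> | \<sigma> permutes D. B (\<lambda>i. x i * ind S i * e (\<sigma> i)))"
      by (simp add: sum_distrib_right shuffle)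
    also have "\<dots> = (\<Sum>\<sigma> | \<sigma> permutes D. \<Sum>S\<in>?P. B (\<lambda>i. x i * ind S i * e (\<sigma> i)))"
      by (rule sum.swap)
    also have "\<dots> = (\<Sum>\<sigma> | \<sigma> permutes D. \<Sum>S\<in>?P. B (\<lambda>i. x i * (e (\<sigma> i) * ind S (\<sigma> i))))"
    proof (rule sum.cong[OF refl])
      fix \<sigma> assume "\<sigma> \<in> {\<sigma>. \<sigma> permutes D}"
      then have \<sigma>: "\<sigma> permutes D" by simp
      note bij = permutes_bij[OF \<sigma>]
      have pre: "\<sigma> -` S \<subseteq> D \<and> card (\<sigma> -` S) = card S" if "S \<subseteq> D" for S
      proof
        show "\<sigma> -` S \<subseteq> D" using that permutes_in_image[OF \<sigma>] by blast
        show "card (\<sigma> -` S) = card S"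
          using bij by (intro card_vimage_inj) (auto simp: bij_def)
      qed
      have img: "\<sigma> ` S \<subseteq> D \<and> card (\<sigma> ` S) = card S" if "S \<subseteq> D" for S
        using that permutes_in_image[OF \<sigma>] bij
        by (auto intro!: card_image simp: bij_def inj_on_subset)
      have "ind (\<sigma> ` S) (\<sigma> i) = ind S i" for S i
        using bij by (simp add: ind_def bij_def inj_image_mem_iff)
      then show "(\<Sum>S\<in>?P. B (\<lambda>i. x i * ind S i * e (\<sigma> i))) =
          (\<Sum>S\<in>?P. B (\<lambda>i. x i * (e (\<sigma> i) * ind S (\<sigma> i))))"
        by (intro sum.reindex_bij_witness[of _ "\<lambda>S. \<sigma> -` S" "\<lambda>S. \<sigma> ` S"])
           (use pre img bij in \<open>auto simp: bij_def inj_vimage_image_eq mult_ac\<close>)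
    qed
    also have "\<dots> = (\<Sum>S\<in>?P. \<Sum>\<sigma> | \<sigma> permutes D. B (\<lambda>i. x i * (e (\<sigma> i) * ind S (\<sigma> i))))"
      by (rule sum.swap)
    also have "\<dots> = (\<Sum>S\<in>?P. B (\<lambda>i. e i * ind S i)) * B x"
      by (simp add: sum_distrib_right shuffle mult.commute[of _ "B x"] sum_distrib_left)
    finally show ?thesis .
  qed
  then show ?thesis
    unfolding ind_def[symmetric]
    using e by (intro exI[of _ "(\<Sum>S\<in>?P. B (\<lambda>i. e i * ind S i)) / B e"])
      (auto simp: field_simps)
qed

text \<open>
  Let \<open>T\<close> be multiplication by \<open>a\<close> in slot \<open>k\<close>. The element \<open>\<Prod>\<^sub>i (T - a\<^sub>i)\<close>, with \<open>a\<^sub>i\<close> the copy of \<open>a\<close> in slot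
  \<open>i\<close>, vanishes because of its factor at \<open>k\<close>. Its coefficients are elementary symmetric, so on \<open>B\<close> they
  act by scalars.
\<close>

lemma Cayley_Hamilton:
  assumes k: "k \<in> D"
  shows "\<exists>p. p \<noteq> 0 \<and> (\<forall>x. (\<Sum>i\<le>degree p. coeff p i * B (\<lambda>j. x j * slot k a j ^ i)) = 0)"
proof -
  define ind where "ind S i = (if i \<in> S then a else 1)" for S and i :: 'i
  define d where "d = card D"
  obtain \<chi> where \<chi>:
    "\<And>j x. (\<Sum>S | S \<subseteq> D \<and> card S = j. B (\<lambda>i. x i * ind S i)) = \<chi> j * B x"
    using elementary_symmetric_scalar[where a = a] unfolding ind_def by metis
  have \<chi>_0: "\<chi> 0 = 1"
  proof -
    obtain e where e: "B e \<noteq> 0" using nonzero by blast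
    have "{S. S \<subseteq> D \<and> card S = 0} = {{}}"
      using finite_D by (auto simp: card_eq_0_iff dest: finite_subset)
    then have "B e = \<chi> 0 * B e" using \<chi>[of e 0] by (simp add: ind_def)
    then show ?thesis using e by simp
  qed
  define p where "p = (\<Sum>i\<le>d. monom ((-1) ^ (d - i) * \<chi> (d - i)) i)"
  have coeff: "coeff p i = (if i \<le> d then (-1) ^ (d - i) * \<chi> (d - i) else 0)" for i
    by (simp add: p_def coeff_sum)
  have deg: "degree p = d"
    by (intro antisym degree_le le_degree) (auto simp: coeff \<chi>_0)
  have "p \<noteq> 0" using coeff[of d] \<chi>_0 by auto
  moreover have "(\<Sum>i\<le>degree p. coeff p i * B (\<lambda>j. x j * slot k a j ^ i)) = 0" for x
  proof -
    define h where "h S = (-1) ^ card S * B (\<lambda>i. x i * slot k a i ^ (d - card S) * ind S i)" for S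
    define D' where "D' = D - {k}"
    have D': "D = insert k D'" "k \<notin> D'" "finite D'" using k finite_D by (auto simp: D'_def)
    \<comment> \<open>\<open>h S\<close> is the term of the expanded product in which the factors at \<open>S\<close> contribute \<open>- a\<^sub>i\<close>;
      the terms of \<open>S\<close> and \<open>insert k S\<close> cancel.\<close>
    have "(\<Sum>i\<le>degree p. coeff p i * B (\<lambda>j. x j * slot k a j ^ i)) =
        (\<Sum>i\<le>d. (-1) ^ (d - i) * \<chi> (d - i) * B (\<lambda>j. x j * slot k a j ^ i))"
      unfolding deg by (simp add: coeff)
    also have "\<dots> = (\<Sum>j\<le>d. (-1) ^ j * (\<chi> j * B (\<lambda>i. x i * slot k a i ^ (d - j))))"
      by (rule sum.reindex_bij_witness[of _ "\<lambda>j. d - j" "\<lambda>j. d - j"]) auto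
    also have "\<dots> = (\<Sum>j\<le>d. \<Sum>S\<in>{S\<in>Pow D. card S = j}. h S)"
      by (intro sum.cong refl) (simp add: h_def \<chi>[symmetric] sum_distrib_left)
    also have "\<dots> = (\<Sum>S\<in>Pow D. h S)"
      by (rule sum.group) (use finite_D card_mono in \<open>auto simp: d_def\<close>)
    also have "\<dots> = (\<Sum>S\<in>Pow D'. h S + h (insert k S))"
      unfolding D'(1) using D'(2,3) by (subst sum_Pow_insert) auto
    also have "\<dots> = 0"
    proof (rule sum.neutral, rule ballI)
      fix S assume "S \<in> Pow D'"
      then have S: "S \<subseteq> D'" "finite S" "k \<notin> S" using D' finite_subset by auto
      have "card S < d"
        using card_mono[OF D'(3) S(1)] D' by (simp add: d_def)
      then obtain m where m: "d = Suc (card S + m)" using less_imp_Suc_add by blast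
      have "slot k a i ^ (d - card S) * ind S i =
          slot k a i ^ (d - card (insert k S)) * ind (insert k S) i" for i
        using S(2,3) by (auto simp: m slot_def ind_def Suc_diff_le)
      then show "h S + h (insert k S) = 0"
        using S(2,3) by (simp add: h_def mult.assoc)
    qed
    finally show ?thesis .
  qed
  ultimately show ?thesis by blast
qed

text \<open>
  Modulo a maximal invariant subspace avoiding \<open>B\<close>, every slot multiplication has \<open>B\<close> as eigenvector.
  The class of \<open>B\<close> is not zero, so eigenvalues are unique and inherit additivity and multiplicativity
  from the translations. Multiplication by \<open>a\<close> in all slots at once has both the given eigenvalue \<open>c\<close>
  and the product of the slot eigenvalues.
\<close>

lemma factor_characters:
  "\<exists>\<phi>. (\<forall>k\<in>D. comm_ring_hom (\<phi> k)) \<and>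
     (\<forall>a c. (\<forall>x. B (\<lambda>i. a * x i) = c * B x) \<longrightarrow> c = (\<Prod>k\<in>D. \<phi> k a))"
proof -
  obtain M where M: "maximal_avoiding B M"
    using maximal_avoiding_exists[of B] nonzero by auto
  then have inv: "invariant_subspace M" and "B \<notin> M"
    by (auto simp: maximal_avoiding_def)
  define eigen where "eigen y u \<longleftrightarrow> (\<lambda>x. translate y B x - u * B x) \<in> M" for y u
  have zero: "u = 0" if "(\<lambda>x. u * B x) \<in> M" for u
  proof (rule ccontr)
    assume "u \<noteq> 0"
    then show False
      using invariant_subspaceD(3)[OF inv that, of "inverse u"] \<open>B \<notin> M\<close>
      by (simp add: mult.assoc[symmetric])
  qed
  have unique: "u = v" if "eigen y u" "eigen y v" for y u v
    using zero[of "v - u"] invariant_subspace_diff[OF inv that[unfolded eigen_def]]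
    by (simp add: algebra_simps)
  have mult: "eigen (\<lambda>i. y i * z i) (u * v)" if "eigen y u" "eigen z v" for y z u v
  proof -
    have "(\<lambda>x. translate z (\<lambda>x. translate y B x - u * B x) x + u * (translate z B x - v * B x)) \<in> M"
      using that unfolding eigen_def by (intro invariant_subspaceD(2-4)[OF inv])
    then show ?thesis
      by (simp add: eigen_def translate_def algebra_simps)
  qed
  have scalar: "eigen y u" if "\<And>x. translate y B x = u * B x" for y u
    using invariant_subspaceD(1)[OF inv] that by (simp add: eigen_def)
  have "\<exists>c. eigen (slot k a) c" if k: "k \<in> D" for k a
  proof -
    obtain p where "p \<noteq> 0"
      and p: "\<And>x. (\<Sum>i\<le>degree p. coeff p i * B (\<lambda>j. x j * slot k a j ^ i)) = 0"
      using Cayley_Hamilton[OF k] by blast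
    then show ?thesis
      using maximal_avoiding_eigenvalue_exists[OF M \<open>p \<noteq> 0\<close>, of "slot k a"]
        invariant_subspaceD(1)[OF inv] unfolding eigen_def by simp
  qed
  then obtain \<phi> where \<phi>: "\<And>k a. k \<in> D \<Longrightarrow> eigen (slot k a) (\<phi> k a)"
    by metis
  have "comm_ring_hom (\<phi> k)" if k: "k \<in> D" for k
  proof -
    have "translate (slot k (a + b)) B x = translate (slot k a) B x + translate (slot k b) B x"
      for a b x
    proof -
      have "translate (slot k c) B x = B (x(k := x k * c))" for c
        unfolding translate_def by (rule local) (simp add: slot_def)
      then show ?thesis using additive[OF k] by (simp add: distrib_left)
    qed
    then have "eigen (slot k (a + b)) (\<phi> k a + \<phi> k b)" for a b
      using invariant_subspaceD(2)[OF inv \<phi>[OF k, of a, unfolded eigen_def] \<phi>[OF k, of b, unfolded eigen_def]]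
      by (simp add: eigen_def algebra_simps)
    then have add: "\<phi> k (a + b) = \<phi> k a + \<phi> k b" for a b
      using unique \<phi>[OF k] by blast
    have "slot k (a * b) = (\<lambda>i. slot k a i * slot k b i)" for a b :: 'a
      by (auto simp: slot_def)
    then have mul: "\<phi> k (a * b) = \<phi> k a * \<phi> k b" for a b
      using unique[OF \<phi>[OF k, of "a * b"]] mult[OF \<phi>[OF k] \<phi>[OF k]] by simp
    have "eigen (slot k 1) 1"
      by (rule scalar) (simp add: translate_def slot_def)
    then have one: "\<phi> k 1 = 1" using unique \<phi>[OF k] by blast
    have "\<phi> k 0 = 0" using add[of 0 0] by (metis add.right_neutral add_left_cancel)
    then show ?thesis by unfold_locales (use add mul one in auto)
  qed
  moreover have "c = (\<Prod>k\<in>D. \<phi> k a)" if c: "\<And>x. B (\<lambda>i. a * x i) = c * B x" for a c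
  proof (rule unique)
    have "eigen (\<lambda>i. if i \<in> X then a else 1) (\<Prod>k\<in>X. \<phi> k a)" if "finite X" "X \<subseteq> D" for X
      using that
    proof induction
      case empty
      show ?case by (rule scalar) (simp add: translate_def)
    next
      case (insert k X)
      have "(\<lambda>i. if i \<in> insert k X then a else 1) = (\<lambda>i. slot k a i * (if i \<in> X then a else 1))"
        using insert.hyps by (auto simp: slot_def)
      then show ?case
        using mult[OF \<phi>[of k a] insert.IH] insert by simp
    qed
    then show "eigen (\<lambda>i. if i \<in> D then a else 1) (\<Prod>k\<in>D. \<phi> k a)"
      using finite_D by simp
    show "eigen (\<lambda>i. if i \<in> D then a else 1) c"
    proof (rule scalar)
      fix x
      have "translate (\<lambda>i. if i \<in> D then a else 1) B x = B (\<lambda>i. a * x i)"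
        unfolding translate_def by (rule local) (simp add: mult.commute)
      then show "translate (\<lambda>i. if i \<in> D then a else 1) B x = c * B x" using c by simp
    qed
  qed
  ultimately show ?thesis by blast
qed

end

section \<open>Products of ring morphisms\<close>

lemma comm_ring_homD:
  assumes "comm_ring_hom h"
  shows "h (a + b) = h a + h b" "h (a * b) = h a * h b" "h 1 = 1"
proof -
  interpret comm_ring_hom h by fact
  show "h (a + b) = h a + h b" "h (a * b) = h a * h b" "h 1 = 1"
    by (rule hom_add hom_mult hom_one)+
qed

text \<open>
  Dedekind's argument: subtracting \<open>g y\<close> times the relation from its translate by \<open>y\<close> removes the
  character \<open>g\<close>. The monoid operation is a parameter, so that it can be the pointwise product of tuples.
\<close>

lemma independence_of_characters:
  fixes c :: "('m \<Rightarrow> 'k::field) \<Rightarrow> 'k" and mul :: "'m \<Rightarrow> 'm \<Rightarrow> 'm"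
  assumes "finite X"
    and "\<And>f x y. f \<in> X \<Longrightarrow> f (mul x y) = f x * f y" and "\<And>f. f \<in> X \<Longrightarrow> \<exists>x. f x \<noteq> 0"
    and "\<And>x. (\<Sum>f\<in>X. c f * f x) = 0" and "f \<in> X"
  shows "c f = 0"
proof -
  have "\<forall>f\<in>X. c f = 0" using assms(1-4)
  proof (induction X arbitrary: c)
    case (insert g X)
    have "c f = 0" if f: "f \<in> X" for f
    proof -
      have "g \<noteq> f" using insert.hyps f by auto
      then obtain y where y: "g y \<noteq> f y" by blast
      have "(\<Sum>f\<in>X. (c f * (f y - g y)) * f x) = 0" for x
      proof -
        have "(\<Sum>f\<in>X. (c f * (f y - g y)) * f x) =
            (\<Sum>f\<in>insert g X. c f * (f (mul y x)) - g y * (c f * f x))"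
          using insert.hyps by (simp add: insert.prems(1) algebra_simps)
        also have "\<dots> = 0"
          using insert.prems(3)[of "mul y x"] insert.prems(3)[of x]
          by (simp only: sum_subtractf sum_distrib_left[symmetric]) simp
        finally show ?thesis .
      qed
      then have "c f * (f y - g y) = 0"
        using insert.IH[of "\<lambda>f. c f * (f y - g y)"] insert.prems(1,2) f by simp
      then show ?thesis using y by simp
    qed
    moreover have "c g = 0"
    proof -
      obtain x where "g x \<noteq> 0" using insert.prems(2) by auto
      moreover have "c g * g x = 0"
        using insert.prems(3)[of x] insert.hyps \<open>\<And>f. f \<in> X \<Longrightarrow> c f = 0\<close> by simp
      ultimately show ?thesis by simp
    qed
    ultimately show ?case by simp
  qed simp
  then show ?thesis using assms(5) by blast
qed

text \<open>
  The restriction only replaces the values outside \<open>D\<close>, where a permutation is the identity and an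
  extensional function is undefined.
\<close>

lemma surjective_self_maps:
  assumes "finite D"
  shows "bij_betw (\<lambda>\<sigma>. restrict \<sigma> D) {\<sigma>. \<sigma> permutes D} {g \<in> D \<rightarrow>\<^sub>E D. g ` D = D}"
proof (rule bij_betwI[where g = "\<lambda>g i. if i \<in> D then g i else i"])
  show "(\<lambda>\<sigma>. restrict \<sigma> D) \<in> {\<sigma>. \<sigma> permutes D} \<rightarrow> {g \<in> D \<rightarrow>\<^sub>E D. g ` D = D}"
    by (auto simp: permutes_in_image permutes_image)
  show "(\<lambda>g i. if i \<in> D then g i else i) \<in> {g \<in> D \<rightarrow>\<^sub>E D. g ` D = D} \<rightarrow> {\<sigma>. \<sigma> permutes D}"
  proof
    fix g assume g: "g \<in> {g \<in> D \<rightarrow>\<^sub>E D. g ` D = D}"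
    then have "bij_betw g D D"
      using assms by (simp add: bij_betw_def eq_card_imp_inj_on)
    then have "bij_betw (\<lambda>i. if i \<in> D then g i else i) D D"
      by (rule bij_betw_cong[THEN iffD1, rotated]) simp
    then show "(\<lambda>i. if i \<in> D then g i else i) \<in> {\<sigma>. \<sigma> permutes D}"
      using bij_imp_permutes by fastforce
  qed
qed (auto simp: restrict_def permutes_not_in PiE_def extensional_def fun_eq_iff)

text \<open>
  Expanding the product of sums gives one term for each map \<open>g : D \<rightarrow> D\<close>, with support \<open>g ` D\<close>. The
  cross effect keeps the surjective ones, which are the permutations.
\<close>

lemma cross_effect_prod:
  fixes \<phi> :: "'i \<Rightarrow> 'a::ab_group_add \<Rightarrow> 'b::comm_ring_1"
  assumes "finite D"
    and add: "\<And>k a b. k \<in> D \<Longrightarrow> \<phi> k (a + b) = \<phi> k a + \<phi> k b"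
  shows "cross_effect (\<lambda>x. \<Prod>k\<in>D. \<phi> k x) D x = (\<Sum>\<sigma> | \<sigma> permutes D. \<Prod>k\<in>D. \<phi> k (x (\<sigma> k)))"
proof -
  let ?J = "D \<rightarrow>\<^sub>E D"
  have sum: "\<phi> k (\<Sum>i\<in>S. x i) = (\<Sum>i\<in>S. \<phi> k (x i))" if "k \<in> D" for k S
  proof -
    have "\<phi> k 0 = 0"
      using add[OF that, of 0 0] by (metis add.right_neutral add_left_cancel)
    then show ?thesis using add[OF that] by (induction S rule: infinite_finite_induct) auto
  qed
  have "cross_effect (\<lambda>x. \<Prod>k\<in>D. \<phi> k x) D x =
      (\<Sum>g\<in>{g \<in> ?J. g ` D = D}. \<Prod>k\<in>D. \<phi> k (x (g k)))"
  proof (rule cross_effect_of_subset_sums)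
    fix S assume S: "S \<subseteq> D"
    have fin: "finite S" using S assms(1) finite_subset by blast
    have "(\<Prod>k\<in>D. \<phi> k (\<Sum>i\<in>S. x i)) = (\<Prod>k\<in>D. \<Sum>i\<in>S. \<phi> k (x i))"
      by (intro prod.cong refl sum)
    also have "\<dots> = (\<Sum>g\<in>D \<rightarrow>\<^sub>E S. \<Prod>k\<in>D. \<phi> k (x (g k)))"
      using assms(1) fin by (rule prod_sum_PiE)
    also have "D \<rightarrow>\<^sub>E S = {g \<in> ?J. g ` D \<subseteq> S}" using S by (auto simp: PiE_def Pi_def)
    also have "(\<Sum>g\<in>{g \<in> ?J. g ` D \<subseteq> S}. \<Prod>k\<in>D. \<phi> k (x (g k))) =
        (\<Sum>g\<in>?J. if g ` D \<subseteq> S then \<Prod>k\<in>D. \<phi> k (x (g k)) else 0)"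
      using assms(1) by (intro sum.inter_filter finite_PiE) auto
    finally show "(\<Prod>k\<in>D. \<phi> k (\<Sum>i\<in>S. x i)) =
        (\<Sum>g\<in>?J. if g ` D \<subseteq> S then \<Prod>k\<in>D. \<phi> k (x (g k)) else 0)" .
  qed (use assms(1) in \<open>auto intro: finite_PiE\<close>)
  also have "\<dots> = (\<Sum>\<sigma> | \<sigma> permutes D. \<Prod>k\<in>D. \<phi> k (x (restrict \<sigma> D k)))"
    by (rule sum.reindex_bij_betw[OF surjective_self_maps[OF assms(1)], symmetric])
  also have "\<dots> = (\<Sum>\<sigma> | \<sigma> permutes D. \<Prod>k\<in>D. \<phi> k (x (\<sigma> k)))"
    by (intro sum.cong prod.cong refl) simp
  finally show ?thesis .
qed

text \<open>
  The characters \<open>x \<mapsto> \<Prod>\<^sub>k \<eta>\<^sub>k(x\<^bsub>\<sigma> k\<^esub>)\<close> of \<open>A\<^sup>D\<close>, summed over \<open>\<sigma>\<close>, give the same cross effect for \<open>\<eta> = \<phi>\<close>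
  and \<open>\<eta> = \<psi>\<close>. The multiplicity of a character, a number of permutations, may vanish in \<open>K\<close> when the
  characteristic is positive; that the cross effect is not zero excludes the case in which all
  of them do.
\<close>

lemma unique_up_to_permutation:
  fixes \<phi> \<psi> :: "'i \<Rightarrow> 'a::comm_ring_1 \<Rightarrow> 'k::field"
  assumes fin: "finite D"
    and \<phi>: "\<And>k. k \<in> D \<Longrightarrow> comm_ring_hom (\<phi> k)" and \<psi>: "\<And>k. k \<in> D \<Longrightarrow> comm_ring_hom (\<psi> k)"
    and eq: "\<And>x. (\<Prod>k\<in>D. \<phi> k x) = (\<Prod>k\<in>D. \<psi> k x)"
    and nz: "cross_effect (\<lambda>x. \<Prod>k\<in>D. \<phi> k x) D e \<noteq> 0"
  shows "image_mset \<phi> (mset_set D) = image_mset \<psi> (mset_set D)"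
proof -
  define P where "P = {\<sigma>. \<sigma> permutes D}"
  have finP: "finite P" unfolding P_def using fin by (rule finite_permutations)
  define char where "char \<eta> \<sigma> x = (\<Prod>k\<in>D. \<eta> k (x (\<sigma> k)))"
    for \<eta> :: "'i \<Rightarrow> 'a \<Rightarrow> 'k" and \<sigma> :: "'i \<Rightarrow> 'i" and x
  define N where "N \<eta> f = (of_nat (card {\<sigma>\<in>P. char \<eta> \<sigma> = f}) :: 'k)"
    for \<eta> :: "'i \<Rightarrow> 'a \<Rightarrow> 'k" and f :: "('i \<Rightarrow> 'a) \<Rightarrow> 'k"
  let ?X = "char \<phi> ` P \<union> char \<psi> ` P"
  have grouped: "(\<Sum>\<sigma>\<in>P. char \<eta> \<sigma> x) = (\<Sum>f\<in>?X. N \<eta> f * f x)"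
    if "\<eta> = \<phi> \<or> \<eta> = \<psi>" for \<eta> :: "'i \<Rightarrow> 'a \<Rightarrow> 'k" and x
  proof -
    have "(\<Sum>f\<in>?X. N \<eta> f * f x) = (\<Sum>f\<in>?X. \<Sum>\<sigma>\<in>{\<sigma>\<in>P. char \<eta> \<sigma> = f}. char \<eta> \<sigma> x)"
      by (intro sum.cong refl) (simp add: N_def)
    also have "\<dots> = (\<Sum>\<sigma>\<in>P. char \<eta> \<sigma> x)"
      by (rule sum.group) (use finP that in auto)
    finally show ?thesis by simp
  qed
  have cross_\<phi>: "cross_effect (\<lambda>x. \<Prod>k\<in>D. \<phi> k x) D x = (\<Sum>\<sigma>\<in>P. char \<phi> \<sigma> x)" for x
    unfolding char_def P_def
    by (rule cross_effect_prod[OF fin]) (use comm_ring_homD(1) \<phi> in blast)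
  have cross_\<psi>: "cross_effect (\<lambda>x. \<Prod>k\<in>D. \<phi> k x) D x = (\<Sum>\<sigma>\<in>P. char \<psi> \<sigma> x)" for x
    unfolding eq char_def P_def
    by (rule cross_effect_prod[OF fin]) (use comm_ring_homD(1) \<psi> in blast)
  show ?thesis
  proof (cases "char \<phi> ` P \<inter> char \<psi> ` P = {}")
    case True
    have mult: "char \<eta> \<sigma> (\<lambda>i. x i * y i) = char \<eta> \<sigma> x * char \<eta> \<sigma> y"
      and one: "char \<eta> \<sigma> (\<lambda>_. 1) = 1"
      if "\<And>k. k \<in> D \<Longrightarrow> comm_ring_hom (\<eta> k)" for \<eta> \<sigma> x y
      unfolding char_def prod.distrib[symmetric]
      by (auto intro!: prod.cong prod.neutral simp: comm_ring_homD[OF that])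
    \<comment> \<open>The two sums of characters agree, so their difference is a linear relation.\<close>
    have difference: "N \<phi> f - N \<psi> f = 0" if "f \<in> ?X" for f
      using _ _ _ _ that
    proof (rule independence_of_characters[where mul = "\<lambda>x y i. x i * y i"
          and c = "\<lambda>f. N \<phi> f - N \<psi> f"])
      show "finite ?X" using finP by simp
      show "f (\<lambda>i. x i * y i) = f x * f y" if "f \<in> ?X" for f x y
        using that mult[OF \<phi>] mult[OF \<psi>] by auto
      show "\<exists>x. f x \<noteq> 0" if "f \<in> ?X" for f
      proof -
        have "f (\<lambda>_. 1) = 1" using that one[OF \<phi>] one[OF \<psi>] by auto
        then show ?thesis by (metis zero_neq_one)
      qed
      show "(\<Sum>f\<in>?X. (N \<phi> f - N \<psi> f) * f x) = 0" for x
        using grouped[of \<phi> x] grouped[of \<psi> x] cross_\<phi>[of x] cross_\<psi>[of x]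
        by (simp add: left_diff_distrib sum_subtractf)
    qed
    have absent: "N \<eta> f = 0" if "f \<notin> char \<eta> ` P" for \<eta> f
    proof -
      have "{\<sigma>\<in>P. char \<eta> \<sigma> = f} = {}" using that by auto
      then show ?thesis by (simp only: N_def card.empty of_nat_0)
    qed
    have "N \<phi> f = 0" if "f \<in> ?X" for f
    proof (cases "f \<in> char \<phi> ` P")
      case in_\<phi>: True
      then have "N \<psi> f = 0" using True absent by blast
      then show ?thesis using difference[OF that] by simp
    qed (rule absent)
    then have "(\<Sum>\<sigma>\<in>P. char \<phi> \<sigma> e) = 0" by (simp add: grouped)
    then show ?thesis using nz cross_\<phi> by simp
  next
    case False
    then obtain \<sigma> \<tau> where perm: "\<sigma> permutes D" "\<tau> permutes D" and "char \<phi> \<sigma> = char \<psi> \<tau>"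
      unfolding P_def by auto
    \<comment> \<open>A character of a tuple concentrated in one slot reveals a single morphism.\<close>
    have at_slot: "char \<eta> \<rho> (slot j a) = \<eta> (Hilbert_Choice.inv \<rho> j) a"
      if "j \<in> D" "\<rho> permutes D" "\<And>k. k \<in> D \<Longrightarrow> comm_ring_hom (\<eta> k)" for \<eta> \<rho> j a
    proof -
      have j: "Hilbert_Choice.inv \<rho> j \<in> D"
        using that(1) permutes_in_image[OF permutes_inv[OF that(2)]] by simp
      have "char \<eta> \<rho> (slot j a) = (\<Prod>k\<in>D. if k = Hilbert_Choice.inv \<rho> j then \<eta> k a else 1)"
        unfolding char_def slot_def
      proof (rule prod.cong[OF refl])
        fix k assume "k \<in> D"
        then have "\<eta> k 1 = 1" using comm_ring_homD(3) that(3) by blast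
        moreover have "\<rho> k = j \<longleftrightarrow> k = Hilbert_Choice.inv \<rho> j"
          using permutes_inv_eq[OF that(2), of j k] by auto
        ultimately show "\<eta> k (if \<rho> k = j then a else 1) =
            (if k = Hilbert_Choice.inv \<rho> j then \<eta> k a else 1)" by simp
      qed
      then show ?thesis using fin j by simp
    qed
    have inv_image:
      "image_mset \<eta> (mset_set D) = image_mset (\<lambda>j. \<eta> (Hilbert_Choice.inv \<rho> j)) (mset_set D)"
      if "\<rho> permutes D" for \<rho> and \<eta> :: "'i \<Rightarrow> 'a \<Rightarrow> 'k"
    proof -
      have "image_mset (Hilbert_Choice.inv \<rho>) (mset_set D) = mset_set (Hilbert_Choice.inv \<rho> ` D)"
        using permutes_inj_on[OF permutes_inv[OF that]] by (rule image_mset_mset_set)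
      also have "Hilbert_Choice.inv \<rho> ` D = D" using permutes_image[OF permutes_inv[OF that]] .
      finally have "image_mset \<eta> (image_mset (Hilbert_Choice.inv \<rho>) (mset_set D)) =
          image_mset \<eta> (mset_set D)"
        by simp
      then show ?thesis by (simp add: multiset.map_comp o_def)
    qed
    have "\<phi> (Hilbert_Choice.inv \<sigma> j) a = \<psi> (Hilbert_Choice.inv \<tau> j) a" if "j \<in> D" for j a
    proof -
      have "char \<phi> \<sigma> (slot j a) = \<phi> (Hilbert_Choice.inv \<sigma> j) a"
        using that perm(1) \<phi> by (rule at_slot)
      moreover have "char \<psi> \<tau> (slot j a) = \<psi> (Hilbert_Choice.inv \<tau> j) a"
        using that perm(2) \<psi> by (rule at_slot)
      ultimately show ?thesis using \<open>char \<phi> \<sigma> = char \<psi> \<tau>\<close> by simp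
    qed
    then have "image_mset (\<lambda>j. \<phi> (Hilbert_Choice.inv \<sigma> j)) (mset_set D) =
        image_mset (\<lambda>j. \<psi> (Hilbert_Choice.inv \<tau> j)) (mset_set D)"
      using fin by (intro image_mset_cong) (auto simp: fun_eq_iff)
    then show ?thesis
      using inv_image[OF perm(1), of \<phi>] inv_image[OF perm(2), of \<psi>] by simp
  qed
qed

lemma mset_as_indexed_family:
  assumes "finite D" "size M = card D"
  shows "\<exists>\<phi>. M = image_mset \<phi> (mset_set D)"
proof -
  obtain xs where xs: "mset xs = M" using ex_mset by blast
  obtain h where h: "bij_betw h D {0..<card D}"
    using ex_bij_betw_finite_nat[OF assms(1)] by blast
  have "image_mset h (mset_set D) = mset_set {0..<card D}"
    using h by (simp add: bij_betw_def image_mset_mset_set)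
  then have "image_mset ((!) xs) (image_mset h (mset_set D)) = mset (map ((!) xs) [0..<length xs])"
    using assms(2) xs by (simp flip: size_mset)
  also have "\<dots> = M" by (simp add: map_nth xs)
  finally have "M = image_mset (\<lambda>k. xs ! h k) (mset_set D)"
    by (simp add: multiset.map_comp o_def)
  then show ?thesis by blast
qed

theorem proposition11:
  fixes \<zeta> :: "'a::comm_ring_1 \<Rightarrow> 'k::alg_closed_field" and d :: nat
  assumes "d > 0"
    and "has_eml_degree d \<zeta>"
    and "\<And>x y. \<zeta> (x * y) = \<zeta> x * \<zeta> y"
  shows "\<exists>!M :: ('a \<Rightarrow> 'k) multiset.
           size M = d \<and> (\<forall>\<phi>\<in>#M. comm_ring_hom \<phi>) \<and> (\<forall>x. \<zeta> x = (\<Prod>\<phi>\<in>#M. \<phi> x))"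
proof -
  let ?D = "{1..d}"
  let ?B = "cross_effect \<zeta> ?D"
  have deg: "eml_degree_le d \<zeta>" and "\<not> eml_degree_le (d - 1) \<zeta>"
    using assms(1,2) by (auto simp: has_eml_degree_def)
  then obtain e where e: "?B e \<noteq> 0"
    using assms(1) by (auto simp: eml_degree_le_def simp flip: cross_effect_eq_deviation)
  interpret shuffle_form ?D ?B
  proof
    show "finite ?D" by simp
    show "?B x = ?B y" if "\<And>i. i \<in> ?D \<Longrightarrow> x i = y i" for x y
      using that by (rule cross_effect_cong)
    show "?B (x(k := a + b)) = ?B (x(k := a)) + ?B (x(k := b))" if "k \<in> ?D" for k x a b
    proof -
      \<comment> \<open>The index \<open>0\<close> lies outside \<open>{1..d}\<close> and serves as the additional variable.\<close>
      let ?z = "x(k := a, 0 := b)"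
      have "cross_effect \<zeta> (insert 0 ?D) ?z = 0"
        using deg by (rule cross_effect_eq_0) auto
      moreover have "?B ?z = ?B (x(k := a))"
        and "?B (?z(k := ?z k + ?z 0)) = ?B (x(k := a + b))"
        and "?B (?z(k := ?z 0)) = ?B (x(k := b))"
        using that by (auto intro!: cross_effect_cong)
      ultimately show ?thesis
        using that by (simp add: cross_effect_insert_insert diff_eq_eq add.commute)
    qed
    show "?B x * ?B y = (\<Sum>\<sigma> | \<sigma> permutes ?D. ?B (\<lambda>i. x i * y (\<sigma> i)))" for x y
      using deg assms(3) by (intro cross_effect_mult) auto
    show "\<exists>e. ?B e \<noteq> 0" using e by blast
  qed
  obtain \<phi> where \<phi>: "\<And>k. k \<in> ?D \<Longrightarrow> comm_ring_hom (\<phi> k)"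
    and prod: "\<And>x. \<zeta> x = (\<Prod>k\<in>?D. \<phi> k x)"
    using factor_characters cross_effect_scale[of \<zeta>, OF assms(3)] by metis
  show ?thesis
  proof (rule ex1I)
    show "size (image_mset \<phi> (mset_set ?D)) = d \<and>
        (\<forall>\<phi>\<in>#image_mset \<phi> (mset_set ?D). comm_ring_hom \<phi>) \<and>
        (\<forall>x. \<zeta> x = (\<Prod>\<phi>\<in>#image_mset \<phi> (mset_set ?D). \<phi> x))"
      using \<phi> prod by (auto simp: multiset.map_comp o_def prod_unfold_prod_mset)
  next
    fix M assume M: "size M = d \<and> (\<forall>\<phi>\<in>#M. comm_ring_hom \<phi>) \<and> (\<forall>x. \<zeta> x = (\<Prod>\<phi>\<in>#M. \<phi> x))"
    then obtain \<psi> where \<psi>: "M = image_mset \<psi> (mset_set ?D)"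
      using mset_as_indexed_family[of ?D M] by auto
    have "\<zeta> = (\<lambda>x. \<Prod>k\<in>?D. \<phi> k x)" using prod by auto
    then show "M = image_mset \<phi> (mset_set ?D)"
      using M e \<phi> unfolding \<psi>
      by (intro unique_up_to_permutation[symmetric, where e = e])
         (auto simp: multiset.map_comp o_def prod_unfold_prod_mset)
  qed
qed

end
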